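(* Suppose we choose $\mathcal T$ uniformly at random from $\overline{\mathsf D}\mathsf{Mot}_{n-1}$. As $n\to\infty$, \[\mathbb E(\mathrm{des}(\mathcal P(\mathcal T))+1)\sim\left(1-\frac{3\sqrt 3}{2\pi}\left(e^{\frac{\pi}{3\sqrt 3}}-1\right)\right)n.\]
   Context: A binary plane tree is a finite rooted tree in which every vertex has at most two children, every child is designated as either a left child or a right child (not both), and no vertex has two left children or two right children. A Motzkin tree is a nonempty binary plane tree in which every child that has no siblings is a left child. $\overline{\mathsf D}\mathsf{Mot}_{m}$ is the set of Motzkin trees with $m$ vertices whose vertices are bijectively labeled with $1,\dots,m$ so that every nonroot vertex has a smaller label than its parent. The postorder reading $\mathcal P$ is defined recursively: $\mathcal P$ of the empty tree is the empty permutation, and $\mathcal P(\mathcal T)=\mathcal P(\mathcal T_L)\,\mathcal P(\mathcal T_R)\,m$ if $\mathcal T$ has root label $m$ and left and right subtrees $\mathcal T_L,\mathcal T_R$. $\mathrm{des}(\pi)$ is the number of indices $i$ with $\pi_i>\pi_{i+1}$. *)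

theory Defs
  imports "HOL-Probability.Probability" "HOL-Library.Tree" "HOL-Library.Landau_Symbols"
begin

text \<open>
  Labeled binary plane trees are rendered by the datatype of \<open>HOL-Library.Tree\<close>: the empty tree is
  \<open>\<langle>\<rangle>\<close>, and \<open>\<langle>l, a, r\<rangle>\<close> has root label \<open>a\<close> and (possibly empty) left and right subtrees \<open>l\<close>, \<open>r\<close>.
  The postorder reading is the library function \<^const>\<open>postorder\<close>, and \<^const>\<open>value\<close> selects
  the root label of a nonempty tree.
\<close>

fun only_children_left :: "'a tree \<Rightarrow> bool" where
  "only_children_left \<langle>\<rangle> \<longleftrightarrow> True"
| "only_children_left \<langle>l, a, r\<rangle> \<longleftrightarrow>
     (r \<noteq> \<langle>\<rangle> \<longrightarrow> l \<noteq> \<langle>\<rangle>) \<and> only_children_left l \<and> only_children_left r"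

definition motzkin_tree :: "'a tree \<Rightarrow> bool" where
  "motzkin_tree t \<longleftrightarrow> t \<noteq> \<langle>\<rangle> \<and> only_children_left t"

fun decreasing_tree :: "'a::linorder tree \<Rightarrow> bool" where
  "decreasing_tree \<langle>\<rangle> \<longleftrightarrow> True"
| "decreasing_tree \<langle>l, a, r\<rangle> \<longleftrightarrow>
     (l \<noteq> \<langle>\<rangle> \<longrightarrow> value l < a) \<and> (r \<noteq> \<langle>\<rangle> \<longrightarrow> value r < a) \<and>
     decreasing_tree l \<and> decreasing_tree r"

text \<open>
  The list \<open>inorder t\<close> contains one entry per vertex of \<open>t\<close>, so its distinctness together with
  \<open>set_tree t = {1..m}\<close> says that the labeling is a bijection from the vertices onto \<open>{1..m}\<close>; in
  particular \<open>t\<close> has exactly \<open>m\<close> vertices.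
\<close>

definition DMot :: "nat \<Rightarrow> nat tree set" where
  "DMot m = {t. motzkin_tree t \<and> decreasing_tree t \<and> distinct (inorder t) \<and> set_tree t = {1..m}}"

definition des :: "'a::linorder list \<Rightarrow> nat" where
  "des xs = card {i. Suc i < length xs \<and> xs ! i > xs ! Suc i}"

text \<open>
  \<^const>\<open>pmf_of_set\<close> is meaningful only on finite nonempty sets; the following facts show that
  it is applied properly for all \<open>m \<ge> 1\<close>.  (There is no Motzkin tree with \<open>0\<close> vertices.)
\<close>

lemma size_DMot: "t \<in> DMot m \<Longrightarrow> size t = m"
  using distinct_card[of "inorder t"] by (simp add: DMot_def)

lemma finite_trees_bounded: "finite A \<Longrightarrow> finite {t. set_tree t \<subseteq> A \<and> size t \<le> m}"
proof (induction m)
  case 0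
  have "{t. set_tree t \<subseteq> A \<and> size t \<le> 0} \<subseteq> {\<langle>\<rangle>}" by auto
  then show ?case using finite_subset by blast
next
  case (Suc m)
  let ?S = "{t. set_tree t \<subseteq> A \<and> size t \<le> m}"
  have "t \<in> insert \<langle>\<rangle> ((\<lambda>(l, a, r). \<langle>l, a, r\<rangle>) ` (?S \<times> A \<times> ?S))"
    if "set_tree t \<subseteq> A" "size t \<le> Suc m" for t
    using that by (cases t) (auto simp: image_iff)
  then have "{t. set_tree t \<subseteq> A \<and> size t \<le> Suc m}
      \<subseteq> insert \<langle>\<rangle> ((\<lambda>(l, a, r). \<langle>l, a, r\<rangle>) ` (?S \<times> A \<times> ?S))"
    by blast
  moreover have "finite (insert \<langle>\<rangle> ((\<lambda>(l, a, r). \<langle>l, a, r\<rangle>) ` (?S \<times> A \<times> ?S)))"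
    using Suc by simp
  ultimately show ?case by (rule finite_subset)
qed

lemma finite_DMot: "finite (DMot m)"
proof (rule finite_subset)
  show "DMot m \<subseteq> {t. set_tree t \<subseteq> {1..m} \<and> size t \<le> m}"
    using size_DMot by (auto simp: DMot_def)
qed (simp add: finite_trees_bounded)

lemma DMot_nonempty: "m \<ge> 1 \<Longrightarrow> DMot m \<noteq> {}"
proof (induction m rule: nat_induct_at_least)
  case base
  have "\<langle>\<langle>\<rangle>, 1, \<langle>\<rangle>\<rangle> \<in> DMot 1" by (simp add: DMot_def motzkin_tree_def)
  then show ?case by blast
next
  case (Suc m)
  then obtain t where t: "t \<in> DMot m" by blast
  then have "value t \<in> set_tree t" by (cases t) (auto simp: DMot_def motzkin_tree_def)
  with t have "value t < Suc m" by (auto simp: DMot_def)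
  with t have "\<langle>t, Suc m, \<langle>\<rangle>\<rangle> \<in> DMot (Suc m)"
    by (auto simp: DMot_def motzkin_tree_def)
  then show ?case by blast
qed

end

theory Submission
  imports Defs "HOL-Complex_Analysis.Cauchy_Integral_Formula"
begin

text \<open>
  Let \<open>M\<close> be the exponential generating function of decreasing Motzkin trees. The root carries the
  greatest label and has no child, a left child, or two children, so \<open>M' = 1 + M + M\<^sup>2\<close>, \<open>M(0) = 0\<close>.
  The postorder reading of \<open>\<langle>l, x, r\<rangle>\<close> with two children has the descents of both subtrees and one
  more exactly if the root label of \<open>l\<close>, which is read last in \<open>l\<close>, exceeds the label read first
  in \<open>r\<close>. So the generating function \<open>D\<close> of the total number of descents satisfies
  \<open>D' = D + 2 M D + (M\<^sup>2 - C)\<close>, where \<open>C\<close> counts the pairs \<open>(l, r)\<close> for which this junction is an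
  ascent.

  In such a pair the greatest label is the root of \<open>r\<close>. Removing it leaves \<open>l\<close> alone, or another
  such pair, or such a pair together with an unconstrained tree; hence \<open>C' = M + C + C M\<close>. With
  \<open>H = 1 + M + C\<close> this becomes \<open>H' = H (1 + M)\<close>, \<open>H(0) = 1\<close>, and the equation for \<open>D\<close> has the closed
  solution \<open>D = (1 + z) M' - H'\<close> (lemma \<open>egf_des_total\<close>). Thus, writing \<open>m\<^sub>n\<close> and \<open>h\<^sub>n\<close> for the
  coefficients of \<open>M\<close> and \<open>H\<close>, the mean number of descents over trees with \<open>n\<close> vertices is exactly
  \<open>n + (n + 1) (m\<^bsub>n+1\<^esub> - h\<^bsub>n+1\<^esub>) / m\<^sub>n\<close>.

  The two differential equations are linearised by \<open>M = - K'/K - 1/2\<close>, \<open>H = e\<^bsup>z/2\<^esup> / K\<close>, where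
  \<open>K'' = - (3/4) K\<close>. Explicitly \<open>K(z) = (2 / \<surd>3) sin (\<surd>3 / 2 (\<rho> - z))\<close> with
  \<open>\<rho> = 2 \<pi> / (3 \<surd>3)\<close>, so in the disc of radius \<open>2 \<rho>\<close> both \<open>M\<close> and \<open>H\<close> have only a simple pole
  at \<open>\<rho>\<close>, with \<open>(\<rho> - z) M \<rightarrow> 1\<close> and \<open>(\<rho> - z) H \<rightarrow> e\<^bsup>\<rho>/2\<^esup>\<close>. Therefore \<open>m\<^sub>n \<sim> \<rho>\<^bsup>-n-1\<^esup>\<close> and
  \<open>h\<^sub>n \<sim> e\<^bsup>\<rho>/2\<^esup> \<rho>\<^bsup>-n-1\<^esup>\<close> (lemma \<open>coeff_asymptotics\<close>), and the mean divided by \<open>n\<close> tends to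
  \<open>1 + (1 - e\<^bsup>\<rho>/2\<^esup>) / \<rho>\<close>, which is the constant claimed.
\<close>

section \<open>Exponential generating functions of functions on finite sets\<close>

text \<open>
  Counting is done directly on arbitrary finite label sets: the recursions below split a label set
  into subsets, and a function given by such a recursion depends on the cardinality alone, so no
  relabelling bijections have to be built. The bound \<open>N\<close> lets the relation serve as an induction
  hypothesis for functions that occur in their own recursion.
\<close>

definition egf_upto :: "nat \<Rightarrow> ('a set \<Rightarrow> 'b::field_char_0) \<Rightarrow> 'b fps \<Rightarrow> bool" where
  "egf_upto N f F \<longleftrightarrow> (\<forall>A. finite A \<and> card A \<le> N \<longrightarrow> f A = fact (card A) * fps_nth F (card A))"

lemma egf_uptoD: "egf_upto N f F \<Longrightarrow> finite A \<Longrightarrow> card A \<le> N \<Longrightarrow> f A = fact (card A) * fps_nth F (card A)"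
  by (simp add: egf_upto_def)

lemma egf_upto_add: "egf_upto N f F \<Longrightarrow> egf_upto N g G \<Longrightarrow> egf_upto N (\<lambda>A. f A + g A) (F + G)"
  by (simp add: egf_upto_def algebra_simps)

lemma egf_upto_diff: "egf_upto N f F \<Longrightarrow> egf_upto N g G \<Longrightarrow> egf_upto N (\<lambda>A. f A - g A) (F - G)"
  by (simp add: egf_upto_def algebra_simps)

lemma egf_upto_empty: "egf_upto N (\<lambda>A. of_bool (A = {})) 1"
  by (auto simp: egf_upto_def)

definition subset_convolution :: "('a set \<Rightarrow> 'b) \<Rightarrow> ('a set \<Rightarrow> 'b) \<Rightarrow> 'a set \<Rightarrow> 'b::field_char_0" where
  "subset_convolution f g A = (\<Sum>S\<in>Pow A. f S * g (A - S))"

text \<open>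
  There are \<open>n choose k\<close> ways to choose the first block with \<open>k\<close> elements, and the binomial
  coefficient turns the product of the factorials into \<open>n!\<close>.
\<close>

lemma egf_upto_convolution:
  assumes f: "egf_upto N f F" and g: "egf_upto N g G"
  shows "egf_upto N (subset_convolution f g) (F * G)"
  unfolding egf_upto_def
proof (intro allI impI, elim conjE)
  fix A :: "'a set" assume A: "finite A" "card A \<le> N"
  define n where "n = card A"
  have summand: "f S * g (A - S) =
      fact k * fps_nth F k * (fact (n - k) * fps_nth G (n - k))" if S: "S \<subseteq> A" "card S = k" for S k
  proof -
    have "finite S" "card (A - S) = n - k" "card S \<le> N" "card (A - S) \<le> N"
      using S A card_mono[OF A(1) S(1)] finite_subset[OF S(1) A(1)]
      by (auto simp: card_Diff_subset n_def)
    then show ?thesis using S A egf_uptoD[OF f, of S] egf_uptoD[OF g, of "A - S"] by simp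
  qed
  have "subset_convolution f g A = (\<Sum>k\<le>n. \<Sum>S | S \<in> Pow A \<and> card S = k. f S * g (A - S))"
    unfolding subset_convolution_def
    by (rule sum.group[symmetric]) (use A in \<open>auto simp: n_def intro: card_mono\<close>)
  also have "\<dots> = (\<Sum>k\<le>n. of_nat (n choose k) * (fact k * fps_nth F k * (fact (n - k) * fps_nth G (n - k))))"
  proof (rule sum.cong[OF refl])
    fix k
    have "(\<Sum>S | S \<in> Pow A \<and> card S = k. f S * g (A - S)) =
        (\<Sum>S | S \<subseteq> A \<and> card S = k. fact k * fps_nth F k * (fact (n - k) * fps_nth G (n - k)))"
      by (rule sum.cong) (auto intro!: summand)
    then show "(\<Sum>S | S \<in> Pow A \<and> card S = k. f S * g (A - S)) =
        of_nat (n choose k) * (fact k * fps_nth F k * (fact (n - k) * fps_nth G (n - k)))"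
      using n_subsets[OF A(1), of k] by (simp add: n_def)
  qed
  also have "\<dots> = (\<Sum>k\<le>n. fact n * (fps_nth F k * fps_nth G (n - k)))"
    by (rule sum.cong[OF refl]) (simp add: binomial_fact)
  finally show "subset_convolution f g A = fact (card A) * fps_nth (F * G) (card A)"
    by (simp add: fps_mult_nth n_def sum_distrib_left atLeast0AtMost)
qed

text \<open>
  Removing the greatest label lowers the size by one, which is differentiation of the generating
  function. Knowing \<open>f\<close> up to size \<open>N\<close> determines \<open>h\<close> up to size \<open>N\<close> and hence \<open>f\<close> up to size
  \<open>N + 1\<close>; a solution of the corresponding differential equation is therefore the generating
  function.
\<close>

lemma egf_of_recursion:
  fixes f :: "'a::linorder set \<Rightarrow> 'b::field_char_0"
  assumes base: "f {} = fps_nth F 0"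
    and rec: "\<And>B x. finite B \<Longrightarrow> (\<And>b. b \<in> B \<Longrightarrow> b < x) \<Longrightarrow> f (insert x B) = h B"
    and ode: "\<And>N. egf_upto N f F \<Longrightarrow> egf_upto N h (fps_deriv F)"
  shows "egf_upto N f F"
proof (induction N)
  case 0
  then show ?case using base by (auto simp: egf_upto_def)
next
  case (Suc N)
  show ?case unfolding egf_upto_def
  proof (intro allI impI, elim conjE)
    fix A :: "'a set" assume A: "finite A" "card A \<le> Suc N"
    show "f A = fact (card A) * fps_nth F (card A)"
    proof (cases "A = {}")
      case False
      define B where "B = A - {Max A}"
      have B: "finite B" "A = insert (Max A) B" "card A = Suc (card B)"
        using A(1) Max_in[OF A(1) False] card.remove[of A "Max A"] unfolding B_def by auto
      have "b < Max A" if "b \<in> B" for b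
        using that A by (auto simp: B_def less_le)
      then have "f A = h B" using rec[of B "Max A"] B by simp
      also have "\<dots> = fact (card B) * fps_nth (fps_deriv F) (card B)"
        using egf_uptoD[OF ode[OF Suc.IH]] A B by simp
      finally show ?thesis using B by (simp add: algebra_simps)
    qed (simp add: base)
  qed
qed

section \<open>Decreasing Motzkin trees on a label set\<close>

definition dmot_on :: "'a::linorder set \<Rightarrow> 'a tree set" where
  "dmot_on A = {t. motzkin_tree t \<and> decreasing_tree t \<and> distinct (inorder t) \<and> set_tree t = A}"

lemma DMot_eq_dmot_on: "DMot m = dmot_on {1..m}"
  by (simp add: DMot_def dmot_on_def)

lemma dmot_on_empty [simp]: "dmot_on {} = {}"
  by (auto simp: dmot_on_def motzkin_tree_def)

lemma set_tree_dmot_on: "t \<in> dmot_on A \<Longrightarrow> set_tree t = A"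
  by (simp add: dmot_on_def)

lemma Leaf_notin_dmot_on: "\<langle>\<rangle> \<notin> dmot_on A"
  by (simp add: dmot_on_def motzkin_tree_def)

lemma finite_dmot_on:
  assumes "finite A" shows "finite (dmot_on A)"
proof (rule finite_subset)
  have "size t = card A" if "t \<in> dmot_on A" for t
    using that distinct_card[of "inorder t"] by (simp add: dmot_on_def)
  then show "dmot_on A \<subseteq> {t. set_tree t \<subseteq> A \<and> size t \<le> card A}"
    by (auto simp: dmot_on_def)
qed (use assms in \<open>simp add: finite_trees_bounded\<close>)

lemma value_in_set_tree: "t \<noteq> \<langle>\<rangle> \<Longrightarrow> value t \<in> set_tree t"
  by (cases t) auto

lemma decreasing_tree_le_value: "decreasing_tree t \<Longrightarrow> x \<in> set_tree t \<Longrightarrow> x \<le> value t"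
proof (induction t arbitrary: x)
  case (Node l a r)
  have sub: "y < a" if "s = l \<or> s = r" "y \<in> set_tree s" for s y
  proof -
    have "s \<noteq> \<langle>\<rangle>" using that(2) by auto
    then have "y \<le> value s" "value s < a" using Node that by auto
    then show ?thesis by simp
  qed
  from Node.prems(2) consider "x = a" | "x \<in> set_tree l" | "x \<in> set_tree r" by auto
  then have "x \<le> a" by cases (use sub[of l] sub[of r] in \<open>auto simp: less_imp_le\<close>)
  then show ?case by simp
qed simp

lemma decreasing_Node_iff:
  "decreasing_tree \<langle>l, a, r\<rangle> \<longleftrightarrow>
     (\<forall>x \<in> set_tree l \<union> set_tree r. x < a) \<and> decreasing_tree l \<and> decreasing_tree r"
proof -
  have "(s \<noteq> \<langle>\<rangle> \<longrightarrow> value s < a) \<longleftrightarrow> (\<forall>x \<in> set_tree s. x < a)" if "decreasing_tree s" for s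
  proof (cases "s = \<langle>\<rangle>")
    case False
    then show ?thesis
      using decreasing_tree_le_value[OF that] value_in_set_tree[of s] order.strict_trans1 by blast
  qed simp
  then show ?thesis unfolding decreasing_tree.simps ball_Un by blast
qed

definition dmot_pairs :: "'a::linorder set \<Rightarrow> ('a tree \<times> 'a tree) set" where
  "dmot_pairs B = (\<Union>S\<in>Pow B. dmot_on S \<times> dmot_on (B - S))"

text \<open>
  The greatest label sits at the root. The three parts are the trees whose root has no child, only
  a left child, and two children.
\<close>

lemma dmot_on_insert_greatest:
  assumes x: "\<And>b. b \<in> B \<Longrightarrow> b < x"
  shows "dmot_on (insert x B) = {t. t = \<langle>\<langle>\<rangle>, x, \<langle>\<rangle>\<rangle> \<and> B = {}}
      \<union> (\<lambda>l. \<langle>l, x, \<langle>\<rangle>\<rangle>) ` dmot_on B \<union> (\<lambda>(l, r). \<langle>l, x, r\<rangle>) ` dmot_pairs B" (is "?lhs = ?rhs")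
proof (rule set_eqI)
  fix t
  have xB: "x \<notin> B" using x by blast
  show "t \<in> ?lhs \<longleftrightarrow> t \<in> ?rhs"
  proof (cases t)
    case Leaf
    then show ?thesis by (auto simp: dmot_on_def motzkin_tree_def)
  next
    case (Node l a r)
    have "a = x \<and> set_tree l \<union> set_tree r = B" if "t \<in> ?lhs"
    proof -
      have *: "\<forall>y \<in> set_tree l \<union> set_tree r. y < a" "insert a (set_tree l \<union> set_tree r) = insert x B"
        using that unfolding Node dmot_on_def mem_Collect_eq decreasing_Node_iff by auto
      then have "a = x" using x by (metis insert_iff order.asym)
      with * xB show ?thesis by (metis insert_ident less_irrefl)
    qed
    then have "t \<in> ?lhs \<longleftrightarrow> a = x \<and> set_tree l \<union> set_tree r = B \<and> set_tree l \<inter> set_tree r = {} \<and>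
        (r \<noteq> \<langle>\<rangle> \<longrightarrow> l \<noteq> \<langle>\<rangle>) \<and> only_children_left l \<and> only_children_left r \<and>
        decreasing_tree l \<and> decreasing_tree r \<and> distinct (inorder l) \<and> distinct (inorder r)"
      using x unfolding Node dmot_on_def mem_Collect_eq decreasing_Node_iff
      by (auto simp: motzkin_tree_def)
    also have "\<dots> \<longleftrightarrow> t \<in> ?rhs"
      unfolding Node by (cases "l = \<langle>\<rangle>"; cases "r = \<langle>\<rangle>")
        (auto simp: dmot_on_def dmot_pairs_def motzkin_tree_def image_iff)
    finally show ?thesis .
  qed
qed

lemma sum_dmot_pairs:
  assumes "finite B"
  shows "sum f (dmot_pairs B) = (\<Sum>S\<in>Pow B. \<Sum>l\<in>dmot_on S. \<Sum>r\<in>dmot_on (B - S). f (l, r))"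
proof -
  have fin: "finite (dmot_on S)" if "S \<subseteq> B" for S
    using that assms finite_subset finite_dmot_on by blast
  have "sum f (dmot_pairs B) = (\<Sum>S\<in>Pow B. sum f (dmot_on S \<times> dmot_on (B - S)))"
    unfolding dmot_pairs_def
    by (rule sum.UNION_disjoint) (use assms fin in \<open>auto dest: set_tree_dmot_on\<close>)
  then show ?thesis by (simp add: sum.cartesian_product case_prod_unfold)
qed

lemma finite_dmot_pairs: "finite B \<Longrightarrow> finite (dmot_pairs B)"
  unfolding dmot_pairs_def by (auto intro!: finite_dmot_on elim: finite_subset)

lemma sum_dmot_on_insert_greatest:
  assumes B: "finite B" and x: "\<And>b. b \<in> B \<Longrightarrow> b < x"
  shows "(\<Sum>t\<in>dmot_on (insert x B). f t) =
      of_bool (B = {}) * f \<langle>\<langle>\<rangle>, x, \<langle>\<rangle>\<rangle> + (\<Sum>l\<in>dmot_on B. f \<langle>l, x, \<langle>\<rangle>\<rangle>) +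
      (\<Sum>(l, r)\<in>dmot_pairs B. f \<langle>l, x, r\<rangle> :: 'b::field_char_0)"
proof -
  let ?one = "{t. t = \<langle>\<langle>\<rangle>, x, \<langle>\<rangle>\<rangle> \<and> B = {}}"
  have one: "finite ?one" "sum f ?one = of_bool (B = {}) * f \<langle>\<langle>\<rangle>, x, \<langle>\<rangle>\<rangle>"
    by (cases "B = {}"; simp)+
  let ?left = "(\<lambda>l. \<langle>l, x, \<langle>\<rangle>\<rangle>) ` dmot_on B" and ?both = "(\<lambda>(l, r). \<langle>l, x, r\<rangle>) ` dmot_pairs B"
  have "?one \<inter> ?left = {}" "(?one \<union> ?left) \<inter> ?both = {}"
    by (auto simp: dmot_pairs_def Leaf_notin_dmot_on)
  then have "sum f (dmot_on (insert x B)) = sum f ?one + sum f ?left + sum f ?both"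
    using B one(1) dmot_on_insert_greatest[of B x] x
    by (simp add: sum.union_disjoint finite_dmot_on finite_dmot_pairs)
  also have "sum f ((\<lambda>l. \<langle>l, x, \<langle>\<rangle>\<rangle>) ` dmot_on B) = (\<Sum>l\<in>dmot_on B. f \<langle>l, x, \<langle>\<rangle>\<rangle>)"
    by (subst sum.reindex) (auto simp: inj_on_def)
  also have "sum f ((\<lambda>(l, r). \<langle>l, x, r\<rangle>) ` dmot_pairs B) = (\<Sum>(l, r)\<in>dmot_pairs B. f \<langle>l, x, r\<rangle>)"
    by (subst sum.reindex) (auto simp: inj_on_def case_prod_unfold)
  finally show ?thesis using one by simp
qed

section \<open>Descents of postorder readings\<close>

lemma des_Cons_Cons: "des (x # y # zs) = of_bool (x > y) + des (y # zs)"
proof -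
  have "{i. Suc i < length (x # y # zs) \<and> (x # y # zs) ! i > (x # y # zs) ! Suc i} =
      {i. i = 0 \<and> x > y} \<union> Suc ` {i. Suc i < length (y # zs) \<and> (y # zs) ! i > (y # zs) ! Suc i}"
    (is "?L = ?R")
  proof (rule set_eqI)
    show "i \<in> ?L \<longleftrightarrow> i \<in> ?R" for i by (cases i) auto
  qed
  then show ?thesis
    unfolding des_def by (simp only:) (subst card_Un_disjoint; auto simp: card_image)
qed

lemma des_singleton [simp]: "des [x] = 0"
  by (simp add: des_def)

lemma des_append:
  "xs \<noteq> [] \<Longrightarrow> ys \<noteq> [] \<Longrightarrow> des (xs @ ys) = des xs + des ys + of_bool (last xs > hd ys)"
proof (induction xs rule: induct_list012)
  case (2 x)
  then show ?case by (cases ys) (simp_all add: des_Cons_Cons)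
qed (auto simp: des_Cons_Cons)

lemma last_postorder: "t \<noteq> \<langle>\<rangle> \<Longrightarrow> last (postorder t) = value t"
  by (cases t) auto

text \<open>
  The root is read last and carries the greatest label, so reading it never creates a descent. A
  descent that is not inside a subtree can only arise where the reading passes from the left to the
  right subtree.
\<close>

lemma des_postorder_left_only:
  assumes "l \<noteq> \<langle>\<rangle>" "\<forall>y\<in>set_tree l. y < x"
  shows "des (postorder \<langle>l, x, \<langle>\<rangle>\<rangle>) = des (postorder l)"
proof -
  have "postorder l \<noteq> []" "value l < x" using assms value_in_set_tree[of l] by (auto simp: neq_Leaf_iff)
  then show ?thesis using assms(1) by (simp add: des_append last_postorder)
qed

lemma des_postorder_two_children:
  assumes "l \<noteq> \<langle>\<rangle>" "r \<noteq> \<langle>\<rangle>" "\<forall>y\<in>set_tree r. y < x"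
  shows "des (postorder \<langle>l, x, r\<rangle>) =
    des (postorder l) + des (postorder r) + of_bool (value l > hd (postorder r))"
proof -
  have "postorder l \<noteq> []" "postorder r \<noteq> []" "value r < x"
    using assms value_in_set_tree[of r] by (auto simp: neq_Leaf_iff)
  then show ?thesis using assms(1,2) by (simp add: des_append last_postorder)
qed

text \<open>
  Both sides run over the ordered partitions of \<open>B\<close> into three blocks: the right one first separates
  the last block, the left one the first. This is associativity of the subset convolution, in a form
  that allows the first two blocks to be coupled.
\<close>

lemma sum_over_three_blocks:
  assumes "finite B"
  shows "(\<Sum>S\<in>Pow B. \<Sum>T\<in>Pow (B - S). f S T (B - S - T)) =
         (\<Sum>U\<in>Pow B. \<Sum>S\<in>Pow U. f S (U - S) (B - U))"
proof -
  have fin: "finite S" if "S \<subseteq> B" for S using that assms by (rule finite_subset)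
  have "(\<Sum>p\<in>Sigma (Pow B) (\<lambda>S. Pow (B - S)). f (fst p) (snd p) (B - fst p - snd p)) =
        (\<Sum>p\<in>Sigma (Pow B) Pow. f (snd p) (fst p - snd p) (B - fst p))"
  proof (rule sum.reindex_bij_witness[where i = "\<lambda>p. (snd p, fst p - snd p)"
        and j = "\<lambda>p. (fst p \<union> snd p, fst p)"], goal_cases)
    case (5 p)
    then have "fst p \<union> snd p - fst p = snd p" "B - (fst p \<union> snd p) = B - fst p - snd p"
      by auto
    then show ?case by simp
  qed auto
  then show ?thesis
    using assms fin by (simp add: sum.Sigma case_prod_unfold)
qed


section \<open>Recursions and their generating functions\<close>

definition dmot_count :: "'a::linorder set \<Rightarrow> 'b::field_char_0" where
  "dmot_count A = (\<Sum>t\<in>dmot_on A. 1)"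

text \<open>
  The pairs at which the reading \<open>postorder l @ postorder r\<close> has no descent at the junction.
\<close>

definition ascent_pairs_count :: "'a::linorder set \<Rightarrow> 'b::field_char_0" where
  "ascent_pairs_count A = (\<Sum>(l, r)\<in>dmot_pairs A. of_bool (value l < hd (postorder r)))"

definition des_total :: "'a::linorder set \<Rightarrow> 'b::field_char_0" where
  "des_total A = (\<Sum>t\<in>dmot_on A. of_nat (des (postorder t)))"

lemma dmot_pairs_count:
  assumes "finite B"
  shows "(\<Sum>p\<in>dmot_pairs B. 1) = (subset_convolution dmot_count dmot_count B :: 'b::field_char_0)"
  using sum_dmot_pairs[OF assms, of "\<lambda>_. 1 :: 'b"]
  by (simp add: subset_convolution_def dmot_count_def)

lemma dmot_count_insert_greatest:
  assumes "finite B" "\<And>b. b \<in> B \<Longrightarrow> b < x"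
  shows "dmot_count (insert x B) =
    of_bool (B = {}) + dmot_count B + (subset_convolution dmot_count dmot_count B :: 'b::field_char_0)"
  unfolding dmot_pairs_count[OF assms(1), symmetric] dmot_count_def
  by (subst sum_dmot_on_insert_greatest[OF assms]) (simp_all add: case_prod_unfold)

lemma hd_postorder_in_set_tree: "t \<noteq> \<langle>\<rangle> \<Longrightarrow> hd (postorder t) \<in> set_tree t"
  using hd_in_set[of "postorder t"] by (cases t) auto

text \<open>
  If the greatest label belonged to the left tree, it would be its root and the junction would be a
  descent. So it is the root of the right tree, and removing it leaves the label read first in the
  right tree unchanged, unless the right tree has only one vertex. The summands are the cases where
  that root has no child, only a left child, and two children; in the last case the pair formed by
  the left tree and the left subtree of the right tree is again counted by \<open>ascent_pairs_count\<close>,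
  while the right subtree is arbitrary.
\<close>

lemma ascent_pairs_count_insert_greatest:
  assumes B: "finite B" and x: "\<And>b. b \<in> B \<Longrightarrow> b < x"
  shows "ascent_pairs_count (insert x B) =
    dmot_count B + ascent_pairs_count B
      + (subset_convolution ascent_pairs_count dmot_count B :: 'b::field_char_0)"
proof -
  let ?P = "\<lambda>l r. of_bool (value l < hd (postorder r)) :: 'b"
  let ?Q = "\<lambda>S T. \<Sum>l\<in>dmot_on S. \<Sum>r\<in>dmot_on T. ?P l r"
  have xB: "x \<notin> B" using x by blast
  have asc: "ascent_pairs_count A = (\<Sum>S\<in>Pow A. ?Q S (A - S))" if "finite A" for A :: "'a set"
    using that by (simp add: ascent_pairs_count_def sum_dmot_pairs)
  \<comment> \<open>\<open>?Q S (A - S)\<close> counts the pairs whose left tree has label set \<open>S\<close>.\<close>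
  have max_left: "?Q (insert x S) (insert x B - insert x S) = 0" if "S \<subseteq> B" for S
  proof (intro sum.neutral ballI)
    fix l r assume l: "l \<in> dmot_on (insert x S)" and r: "r \<in> dmot_on (insert x B - insert x S)"
    have "x \<le> value l"
      using l by (auto simp: dmot_on_def intro: decreasing_tree_le_value)
    moreover have "hd (postorder r) \<in> B"
      using r hd_postorder_in_set_tree[of r] Leaf_notin_dmot_on by (auto simp: dmot_on_def)
    ultimately show "?P l r = 0" using x[of "hd (postorder r)"] by auto
  qed
  have max_right: "?Q S (insert x B - S) = of_bool (S = B) * dmot_count S + ?Q S (B - S)
      + (\<Sum>T\<in>Pow (B - S). ?Q S T * dmot_count (B - S - T))" if S: "S \<subseteq> B" for S
  proof -
    have eq: "insert x B - S = insert x (B - S)" "B - S = {} \<longleftrightarrow> S = B" using S xB by auto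
    have "(\<Sum>r\<in>dmot_on (insert x (B - S)). ?P l r) = of_bool (S = B) + (\<Sum>r\<in>dmot_on (B - S). ?P l r)
        + (\<Sum>T\<in>Pow (B - S). (\<Sum>r\<in>dmot_on T. ?P l r) * dmot_count (B - S - T))"
      if l: "l \<in> dmot_on S" for l
    proof -
      have "l \<noteq> \<langle>\<rangle>" "set_tree l = S" using l Leaf_notin_dmot_on by (auto simp: dmot_on_def)
      then have vl: "value l < x" using value_in_set_tree[of l] S x by auto
      have hd: "hd (postorder \<langle>r, x, r'\<rangle>) = hd (postorder r)" if "r \<noteq> \<langle>\<rangle>" for r r'
        using that by (cases r) (simp_all add: hd_append)
      have "(\<Sum>r\<in>dmot_on (insert x (B - S)). ?P l r) =
          of_bool (B - S = {}) * ?P l \<langle>\<langle>\<rangle>, x, \<langle>\<rangle>\<rangle> + (\<Sum>r\<in>dmot_on (B - S). ?P l \<langle>r, x, \<langle>\<rangle>\<rangle>)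
            + (\<Sum>(r, r')\<in>dmot_pairs (B - S). ?P l \<langle>r, x, r'\<rangle>)"
        by (rule sum_dmot_on_insert_greatest) (use B x in auto)
      also have "of_bool (B - S = {}) * ?P l \<langle>\<langle>\<rangle>, x, \<langle>\<rangle>\<rangle> = of_bool (S = B)"
        using vl eq(2) by simp
      also have "(\<Sum>r\<in>dmot_on (B - S). ?P l \<langle>r, x, \<langle>\<rangle>\<rangle>) = (\<Sum>r\<in>dmot_on (B - S). ?P l r)"
        by (rule sum.cong[OF refl], subst hd) (use Leaf_notin_dmot_on in auto)
      also have "(\<Sum>(r, r')\<in>dmot_pairs (B - S). ?P l \<langle>r, x, r'\<rangle>) = (\<Sum>(r, r')\<in>dmot_pairs (B - S). ?P l r)"
      proof (rule sum.cong[OF refl], clarify)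
        fix r r' assume "(r, r') \<in> dmot_pairs (B - S)"
        then have "r \<noteq> \<langle>\<rangle>" using Leaf_notin_dmot_on by (auto simp: dmot_pairs_def)
        then have "hd (postorder \<langle>r, x, r'\<rangle>) = hd (postorder r)" by (rule hd)
        then show "?P l \<langle>r, x, r'\<rangle> = ?P l r" by (simp only:)
      qed
      also have "(\<Sum>(r, r')\<in>dmot_pairs (B - S). ?P l r) =
          (\<Sum>T\<in>Pow (B - S). (\<Sum>r\<in>dmot_on T. ?P l r) * dmot_count (B - S - T))"
        using B by (simp add: sum_dmot_pairs dmot_count_def sum_distrib_left sum_distrib_right mult.commute)
      finally show ?thesis .
    qed
    then have "?Q S (insert x (B - S)) = (\<Sum>l\<in>dmot_on S. of_bool (S = B)) + ?Q S (B - S)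
        + (\<Sum>l\<in>dmot_on S. \<Sum>T\<in>Pow (B - S). (\<Sum>r\<in>dmot_on T. ?P l r) * dmot_count (B - S - T))"
      unfolding sum.distrib[symmetric] by (intro sum.cong refl)
    also have "(\<Sum>l\<in>dmot_on S. \<Sum>T\<in>Pow (B - S). (\<Sum>r\<in>dmot_on T. ?P l r) * dmot_count (B - S - T)) =
        (\<Sum>T\<in>Pow (B - S). ?Q S T * dmot_count (B - S - T))"
      by (subst sum.swap) (simp only: sum_distrib_right)
    finally show ?thesis unfolding eq by (simp add: dmot_count_def)
  qed
  have "ascent_pairs_count (insert x B) = (\<Sum>S\<in>Pow (insert x B). ?Q S (insert x B - S))"
    using B by (simp add: asc)
  also have "\<dots> = (\<Sum>S\<in>Pow B. ?Q S (insert x B - S)) + (\<Sum>S\<in>insert x ` Pow B. ?Q S (insert x B - S))"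
    unfolding Pow_insert using B xB by (intro sum.union_disjoint) auto
  also have "(\<Sum>S\<in>insert x ` Pow B. ?Q S (insert x B - S)) = 0"
    using max_left by (intro sum.neutral) auto
  also have "(\<Sum>S\<in>Pow B. ?Q S (insert x B - S)) = (\<Sum>S\<in>Pow B. of_bool (S = B) * dmot_count S)
      + (\<Sum>S\<in>Pow B. ?Q S (B - S)) + (\<Sum>S\<in>Pow B. \<Sum>T\<in>Pow (B - S). ?Q S T * dmot_count (B - S - T))"
    using max_right by (simp add: sum.distrib)
  also have "(\<Sum>S\<in>Pow B. of_bool (S = B) * dmot_count S) = (dmot_count B :: 'b)"
    using B sum.delta[of "Pow B" B "dmot_count :: _ \<Rightarrow> 'b"] by (simp add: of_bool_def if_distrib if_distribR cong: if_cong)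
  also have "(\<Sum>S\<in>Pow B. \<Sum>T\<in>Pow (B - S). ?Q S T * dmot_count (B - S - T)) =
      subset_convolution ascent_pairs_count dmot_count B"
    unfolding sum_over_three_blocks[OF B, of "\<lambda>S T R. ?Q S T * dmot_count R"] subset_convolution_def
    using B by (intro sum.cong refl) (auto simp: asc sum_distrib_right finite_subset)
  finally show ?thesis using B by (simp add: asc)
qed

text \<open>
  The last summand counts the pairs with a descent at the junction: the two labels there come from
  disjoint sets, so these are the pairs that are not counted by \<open>ascent_pairs_count\<close>.
\<close>

lemma des_total_insert_greatest:
  assumes B: "finite B" and x: "\<And>b. b \<in> B \<Longrightarrow> b < x"
  shows "des_total (insert x B) = des_total B
    + (subset_convolution des_total dmot_count B + subset_convolution dmot_count des_total B)
    + (subset_convolution dmot_count dmot_count B - ascent_pairs_count B :: 'b::field_char_0)"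
proof -
  let ?d = "\<lambda>t. of_nat (des (postorder t)) :: 'b"
  have left: "?d \<langle>l, x, \<langle>\<rangle>\<rangle> = ?d l" if "l \<in> dmot_on B" for l
    using that x des_postorder_left_only[of l x] Leaf_notin_dmot_on by (auto simp: dmot_on_def)
  have both: "?d \<langle>l, x, r\<rangle> = ?d l + ?d r + (1 - of_bool (value l < hd (postorder r)))"
    if lr: "(l, r) \<in> dmot_pairs B" for l r
  proof -
    obtain S where S: "S \<subseteq> B" "l \<in> dmot_on S" "r \<in> dmot_on (B - S)"
      using lr by (auto simp: dmot_pairs_def)
    then have ne: "l \<noteq> \<langle>\<rangle>" "r \<noteq> \<langle>\<rangle>" using Leaf_notin_dmot_on by auto
    have "value l \<in> S" "hd (postorder r) \<in> B - S" "\<forall>y\<in>set_tree r. y < x"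
      using value_in_set_tree[OF ne(1)] hd_postorder_in_set_tree[OF ne(2)] S x
      by (auto simp: dmot_on_def)
    then have "value l \<noteq> hd (postorder r)" by auto
    with des_postorder_two_children[OF ne \<open>\<forall>y\<in>set_tree r. y < x\<close>] show ?thesis
      by (auto simp: of_bool_def)
  qed
  have "des_total (insert x B) = (\<Sum>l\<in>dmot_on B. ?d \<langle>l, x, \<langle>\<rangle>\<rangle>) + (\<Sum>(l, r)\<in>dmot_pairs B. ?d \<langle>l, x, r\<rangle>)"
    unfolding des_total_def by (subst sum_dmot_on_insert_greatest[OF B x]) simp_all
  also have "(\<Sum>l\<in>dmot_on B. ?d \<langle>l, x, \<langle>\<rangle>\<rangle>) = des_total B"
    using left by (simp add: des_total_def del: postorder.simps)
  also have "(\<Sum>(l, r)\<in>dmot_pairs B. ?d \<langle>l, x, r\<rangle>) =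
      (\<Sum>(l, r)\<in>dmot_pairs B. ?d l + ?d r + (1 - of_bool (value l < hd (postorder r))))"
    using both by (intro sum.cong) (auto simp del: postorder.simps)
  also have "\<dots> = (\<Sum>(l, r)\<in>dmot_pairs B. ?d l) + (\<Sum>(l, r)\<in>dmot_pairs B. ?d r)
      + ((\<Sum>p\<in>dmot_pairs B. 1) - ascent_pairs_count B)"
    unfolding ascent_pairs_count_def case_prod_unfold by (simp only: sum.distrib sum_subtractf)
  also have "(\<Sum>(l, r)\<in>dmot_pairs B. ?d l) = subset_convolution des_total dmot_count B"
    using B by (simp add: sum_dmot_pairs subset_convolution_def des_total_def dmot_count_def
        sum_distrib_left sum_distrib_right mult.commute)
  also have "(\<Sum>(l, r)\<in>dmot_pairs B. ?d r) = subset_convolution dmot_count des_total B"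
    using B by (simp add: sum_dmot_pairs subset_convolution_def des_total_def dmot_count_def)
  finally show ?thesis using dmot_pairs_count[OF B] by simp
qed

lemma empty_counts:
  "dmot_count {} = 0" "ascent_pairs_count {} = 0" "des_total {} = 0"
  by (simp_all add: dmot_count_def ascent_pairs_count_def des_total_def dmot_pairs_def)

text \<open>
  The differential equations alone determine the counts, so the coefficients of any solution can be
  used; closed forms enter only in the next section.
\<close>

context
  fixes M H :: "'b::field_char_0 fps"
  assumes M_0: "fps_nth M 0 = 0" and M_ode: "fps_deriv M = 1 + M + M * M"
    and H_0: "fps_nth H 0 = 1" and H_ode: "fps_deriv H = H * (1 + M)"
begin

lemma egf_dmot_count: "egf_upto N (dmot_count :: 'a::linorder set \<Rightarrow> 'b) M"
proof -
  define h :: "'a set \<Rightarrow> 'b" where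
    "h B = of_bool (B = {}) + dmot_count B + subset_convolution dmot_count dmot_count B" for B
  have "egf_upto N h (fps_deriv M)" if "egf_upto N (dmot_count :: 'a set \<Rightarrow> 'b) M" for N
    unfolding M_ode h_def using that
    by (intro egf_upto_add egf_upto_empty egf_upto_convolution)
  then show ?thesis
    by (rule egf_of_recursion[where h = h, rotated 2])
      (simp_all add: M_0 empty_counts dmot_count_insert_greatest h_def)
qed

lemma egf_ascent_pairs_count:
  "egf_upto N (ascent_pairs_count :: 'a::linorder set \<Rightarrow> 'b) (H - 1 - M)"
proof -
  define h :: "'a set \<Rightarrow> 'b" where
    "h B = dmot_count B + ascent_pairs_count B + subset_convolution ascent_pairs_count dmot_count B" for B
  have ode: "fps_deriv (H - 1 - M) = M + (H - 1 - M) + (H - 1 - M) * M"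
    by (simp add: M_ode H_ode algebra_simps)
  have "egf_upto N h (fps_deriv (H - 1 - M))"
    if "egf_upto N (ascent_pairs_count :: 'a set \<Rightarrow> 'b) (H - 1 - M)" for N
    unfolding ode h_def using that
    by (intro egf_upto_add egf_upto_convolution egf_dmot_count)
  then show ?thesis
    by (rule egf_of_recursion[where h = h, rotated 2])
      (simp_all add: M_0 H_0 empty_counts ascent_pairs_count_insert_greatest h_def)
qed

text \<open>
  The homogeneous equation \<open>D' = (1 + 2 M) D\<close> is solved by \<open>M'\<close>, because \<open>M'' = (1 + 2 M) M'\<close>. The
  inhomogeneity is \<open>M\<^sup>2 - C = M' - H\<close>; variation of constants for the part \<open>M'\<close> gives \<open>z M'\<close>, the
  part \<open>H\<close> is accounted for by \<open>H' = H (1 + M)\<close>, and adding \<open>M'\<close> once makes \<open>D(0) = 0\<close>.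
\<close>

lemma egf_des_total:
  "egf_upto N (des_total :: 'a::linorder set \<Rightarrow> 'b) ((1 + fps_X) * fps_deriv M - fps_deriv H)"
  (is "egf_upto N _ ?D")
proof -
  define h :: "'a set \<Rightarrow> 'b" where "h B = des_total B
    + (subset_convolution des_total dmot_count B + subset_convolution dmot_count des_total B)
    + (subset_convolution dmot_count dmot_count B - ascent_pairs_count B)" for B
  have ode: "fps_deriv ?D = ?D + (?D * M + M * ?D) + (M * M - (H - 1 - M))"
    by (simp add: M_ode H_ode algebra_simps)
  have "egf_upto N h (fps_deriv ?D)" if "egf_upto N (des_total :: 'a set \<Rightarrow> 'b) ?D" for N
    unfolding ode h_def using that
    by (intro egf_upto_add egf_upto_diff egf_upto_convolution egf_dmot_count egf_ascent_pairs_count)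
  then show ?thesis
    by (rule egf_of_recursion[where h = h, rotated 2])
      (simp_all add: M_0 H_0 M_ode H_ode empty_counts des_total_insert_greatest h_def)
qed

lemma mean_descents:
  assumes "n \<ge> 1"
  shows "1 + des_total {1..n} / dmot_count {1..n} =
    of_nat (n + 1) + of_nat (n + 1) * (fps_nth M (n + 1) - fps_nth H (n + 1)) / fps_nth M n"
proof -
  let ?D = "(1 + fps_X) * fps_deriv M - fps_deriv H"
  have cnt: "dmot_count {1..n} = fact n * fps_nth M n"
    using egf_uptoD[OF egf_dmot_count, of "{1..n}" n] by simp
  have "dmot_count {1..n} = (of_nat (card (DMot n)) :: 'b)"
    by (simp add: dmot_count_def DMot_eq_dmot_on)
  moreover have "card (DMot n) \<noteq> 0"
    using finite_DMot DMot_nonempty[OF assms] by simp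
  ultimately have nz: "fps_nth M n \<noteq> 0" using cnt by auto
  have "des_total {1..n} = fact n * fps_nth ?D n"
    using egf_uptoD[OF egf_des_total, of "{1..n}" n] by simp
  moreover have "fps_nth ?D n = of_nat (n + 1) * (fps_nth M (n + 1) - fps_nth H (n + 1)) + of_nat n * fps_nth M n"
    using assms by (cases n) (simp_all add: algebra_simps)
  ultimately have "des_total {1..n} / dmot_count {1..n} =
      of_nat (n + 1) * (fps_nth M (n + 1) - fps_nth H (n + 1)) / fps_nth M n + of_nat n"
    using cnt nz by (simp add: add_divide_distrib)
  then show ?thesis by simp
qed

end


section \<open>Explicit generating functions\<close>

definition sqrt3 :: complex where "sqrt3 = of_real (sqrt 3)"

lemma sqrt3_square: "sqrt3 * sqrt3 = 3"
  unfolding sqrt3_def of_real_mult[symmetric] by simp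

lemma sqrt3_nonzero [simp]: "sqrt3 \<noteq> 0"
  by (simp add: sqrt3_def)

text \<open>
  The power series of \<open>cos (\<surd>3 / 2 z + \<pi> / 6) / cos (\<pi> / 6)\<close>. The substitution
  \<open>M = - K'/K - 1/2\<close> turns the Riccati equation \<open>M' = 1 + M + M\<^sup>2\<close> into \<open>K'' = - (3/4) K\<close>, and the
  phase \<open>\<pi> / 6\<close> is the one for which \<open>M(0) = 0\<close>.
\<close>

definition kernel_fps :: "complex fps" where
  "kernel_fps = fps_cos (sqrt3 / 2) - fps_const (1 / sqrt3) * fps_sin (sqrt3 / 2)"

definition motzkin_fps :: "complex fps" where
  "motzkin_fps = - fps_deriv kernel_fps * inverse kernel_fps - fps_const (1 / 2)"

text \<open>
  Integrating \<open>H'/H = 1 + M = 1/2 - K'/K\<close> gives this formula.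
\<close>

definition ascent_fps :: "complex fps" where
  "ascent_fps = fps_exp (1 / 2) * inverse kernel_fps"

lemma kernel_fps_0: "fps_nth kernel_fps 0 = 1"
  by (simp add: kernel_fps_def)

lemma kernel_fps_inverse: "kernel_fps * inverse kernel_fps = 1"
  by (simp add: inverse_mult_eq_1' kernel_fps_0)

lemma deriv_kernel_fps:
  "fps_deriv kernel_fps = - fps_const (sqrt3 / 2) * fps_sin (sqrt3 / 2) - fps_const (1 / 2) * fps_cos (sqrt3 / 2)"
proof -
  have "fps_const (1 / sqrt3) * (fps_const (sqrt3 / 2) * F) = fps_const (1 / 2) * F" for F
    by (simp flip: mult.assoc)
  then show ?thesis unfolding kernel_fps_def by (simp add: fps_sin_deriv fps_cos_deriv)
qed

lemma deriv2_kernel_fps: "fps_deriv (fps_deriv kernel_fps) = fps_const (- (3 / 4)) * kernel_fps"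
proof -
  have c: "sqrt3 / 2 * (sqrt3 / 2) = 3 / 4" "1 / 2 * (sqrt3 / 2) = 3 / 4 * (1 / sqrt3)"
    using sqrt3_square by (simp_all add: field_simps)
  have "fps_nth (fps_deriv (fps_deriv kernel_fps)) n
      = - (sqrt3 / 2 * (sqrt3 / 2)) * fps_nth (fps_cos (sqrt3 / 2)) n
        + (1 / 2 * (sqrt3 / 2)) * fps_nth (fps_sin (sqrt3 / 2)) n" for n
    unfolding deriv_kernel_fps by (simp add: fps_sin_deriv fps_cos_deriv del: fps_deriv_nth)
  then show ?thesis
    unfolding c by (intro fps_ext) (simp add: kernel_fps_def algebra_simps)
qed

lemma motzkin_fps_0: "fps_nth motzkin_fps 0 = 0"
  by (simp add: motzkin_fps_def deriv_kernel_fps kernel_fps_0)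

lemma deriv_inverse_kernel_fps:
  "fps_deriv (inverse kernel_fps) = - fps_deriv kernel_fps * (inverse kernel_fps * inverse kernel_fps)"
  by (simp add: fps_inverse_deriv kernel_fps_0 power2_eq_square)

lemma motzkin_fps_ode: "fps_deriv motzkin_fps = 1 + motzkin_fps + motzkin_fps * motzkin_fps"
proof -
  define P where "P = fps_deriv kernel_fps * inverse kernel_fps"
  define h :: "complex fps" where "h = fps_const (1 / 2)"
  have M: "motzkin_fps = - P - h" by (simp add: motzkin_fps_def P_def h_def)
  have h: "h + h = 1" "fps_const (3 / 4) = 1 - h + h * h"
    by (simp_all add: h_def flip: fps_const_1_eq_1)
  have "fps_deriv motzkin_fps =
      - (fps_deriv kernel_fps * fps_deriv (inverse kernel_fps) + fps_deriv (fps_deriv kernel_fps) * inverse kernel_fps)"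
    by (simp add: motzkin_fps_def)
  also have "\<dots> = - fps_const (- (3 / 4)) * (kernel_fps * inverse kernel_fps) + P * P"
    unfolding deriv2_kernel_fps deriv_inverse_kernel_fps P_def by algebra
  also have "\<dots> = fps_const (3 / 4) + P * P" by (simp add: kernel_fps_inverse)
  also have "\<dots> = 1 + motzkin_fps + motzkin_fps * motzkin_fps" using M h by algebra
  finally show ?thesis .
qed

lemma ascent_fps_0: "fps_nth ascent_fps 0 = 1"
  by (simp add: ascent_fps_def kernel_fps_0)

lemma ascent_fps_ode: "fps_deriv ascent_fps = ascent_fps * (1 + motzkin_fps)"
proof -
  define h :: "complex fps" where "h = fps_const (1 / 2)"
  have "h + h = 1" by (simp add: h_def flip: fps_const_1_eq_1)
  then have half: "e * (- d * (i * i)) + h * e * i = e * i * (1 + (- d * i - h))" for e d i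
    by algebra
  have "fps_deriv ascent_fps = fps_exp (1 / 2) * fps_deriv (inverse kernel_fps) + h * fps_exp (1 / 2) * inverse kernel_fps"
    by (simp add: ascent_fps_def h_def)
  then show ?thesis
    unfolding deriv_inverse_kernel_fps half by (simp add: ascent_fps_def motzkin_fps_def h_def)
qed

section \<open>The dominant singularity\<close>

text \<open>
  If \<open>F = g / (\<rho> - z)\<close>, then the \<open>n\<close>-th coefficient of \<open>F\<close>, scaled by \<open>\<rho>\<^bsup>n+1\<^esup>\<close>, is the \<open>n\<close>-th
  partial sum of the Taylor series of \<open>g\<close> at the point \<open>\<rho>\<close>, which lies inside the disc where \<open>g\<close> is
  holomorphic.
\<close>

lemma coeff_asymptotics_simple_pole:
  fixes F :: "complex fps"
  assumes g: "g holomorphic_on ball 0 R" and "\<rho> \<noteq> 0" "norm \<rho> < R"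
    and exp: "g has_fps_expansion ((fps_const \<rho> - fps_X) * F)"
  shows "(\<lambda>n. fps_nth F n * \<rho> ^ Suc n) \<longlonglongrightarrow> g \<rho>"
proof -
  let ?G = "(fps_const \<rho> - fps_X) * F"
  have "(\<lambda>n. (deriv ^^ n) g 0 / fact n * (\<rho> - 0) ^ n) sums g \<rho>"
    using g assms by (intro holomorphic_power_series) auto
  then have "(\<lambda>n. fps_nth ?G n * \<rho> ^ n) sums g \<rho>"
    using fps_nth_fps_expansion[OF exp] by simp
  then have "(\<lambda>n. \<Sum>k\<le>n. fps_nth ?G k * \<rho> ^ k) \<longlonglongrightarrow> g \<rho>"
    by (simp add: sums_def_le)
  moreover have "(\<Sum>k\<le>n. fps_nth ?G k * \<rho> ^ k) = fps_nth F n * \<rho> ^ Suc n" for n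
    by (induction n) (simp_all add: algebra_simps)
  ultimately show ?thesis by simp
qed

definition radius :: real where "radius = 2 * pi / (3 * sqrt 3)"

definition kernel :: "complex \<Rightarrow> complex" where
  "kernel z = cos (sqrt3 / 2 * z) - 1 / sqrt3 * sin (sqrt3 / 2 * z)"

lemma kernel_has_fps_expansion: "kernel has_fps_expansion kernel_fps"
  unfolding kernel_def [abs_def] kernel_fps_def by (intro fps_expansion_intros)

lemma kernel_eq_sin: "kernel z = 2 / sqrt3 * sin (sqrt3 / 2 * (of_real radius - z))"
proof -
  have arg: "sqrt3 / 2 * (of_real radius - z) = of_real (pi / 3) - sqrt3 / 2 * z"
    by (simp add: sqrt3_def radius_def algebra_simps)
  have trig: "sin (complex_of_real (pi / 3)) = sqrt3 / 2" "cos (complex_of_real (pi / 3)) = 1 / 2"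
    unfolding sqrt3_def sin_of_real cos_of_real sin_60 cos_60 by simp_all
  show ?thesis
    unfolding kernel_def arg sin_diff trig by (simp add: right_diff_distrib)
qed

lemma radius_pos: "radius > 0"
  by (simp add: radius_def)

text \<open>
  Consecutive zeros are \<open>2 \<pi> / \<surd>3 = 3 \<rho>\<close> apart, so those next to \<open>\<rho>\<close> are \<open>-2 \<rho>\<close> and \<open>4 \<rho>\<close>.
\<close>

lemma kernel_zero_iff:
  assumes "z \<in> ball 0 (2 * radius)"
  shows "kernel z = 0 \<longleftrightarrow> z = of_real radius"
proof
  assume "kernel z = 0"
  then have "sin (sqrt3 / 2 * (of_real radius - z)) = 0"
    unfolding kernel_eq_sin by (simp only: mult_eq_0_iff divide_eq_0_iff sqrt3_nonzero) simp
  then obtain k :: int where k: "sqrt3 / 2 * (of_real radius - z) = of_real (k * pi)"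
    unfolding sin_eq_0 by blast
  have "norm (of_real radius - z) < radius + 2 * radius"
    using norm_triangle_ineq4[of "of_real radius" z] assms radius_pos by simp
  moreover have "norm (of_real radius - z) = 2 / sqrt 3 * (\<bar>real_of_int k\<bar> * pi)"
    using arg_cong[OF k, of norm] unfolding norm_mult norm_divide norm_of_real abs_mult
    by (simp add: sqrt3_def field_simps)
  ultimately have "\<bar>real_of_int k\<bar> < 1"
    by (simp add: radius_def field_simps)
  then have "k = 0" by simp
  with k show "z = of_real radius" by simp
qed (simp add: kernel_eq_sin)

lemma kernel_holomorphic: "kernel holomorphic_on A"
  unfolding kernel_def [abs_def] by (intro holomorphic_intros) auto

lemma deriv_kernel_radius: "deriv kernel (of_real radius) = -1"
proof (rule DERIV_imp_deriv)
  show "(kernel has_field_derivative -1) (at (of_real radius))"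
    unfolding kernel_eq_sin [abs_def] by (auto intro!: derivative_eq_intros)
qed

text \<open>
  The zero of the kernel at \<open>\<rho>\<close> is simple with derivative \<open>-1\<close>, so \<open>(\<rho> - z) / K(z)\<close> extends
  holomorphically to the whole disc, with value \<open>1\<close> at \<open>\<rho>\<close>.
\<close>

lemma inverse_kernel_simple_pole:
  obtains Q where "Q holomorphic_on ball 0 (2 * radius)" "Q (of_real radius) = 1"
    "Q has_fps_expansion ((fps_const (of_real radius) - fps_X) * inverse kernel_fps)"
proof -
  let ?\<rho> = "complex_of_real radius" and ?B = "ball 0 (2 * radius) :: complex set"
  define S where "S z = (if z = ?\<rho> then deriv kernel ?\<rho> else (kernel z - kernel ?\<rho>) / (z - ?\<rho>))" for z
  define Q where "Q z = - inverse (S z)" for z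
  have \<rho>: "?\<rho> \<in> ?B" "kernel ?\<rho> = 0" using radius_pos by (simp_all add: kernel_eq_sin)
  have "S holomorphic_on ?B"
    unfolding S_def [abs_def] using \<rho> by (intro pole_lemma kernel_holomorphic) auto
  moreover have "S z \<noteq> 0" if "z \<in> ?B" for z
    using kernel_zero_iff[OF that] by (simp add: S_def deriv_kernel_radius \<rho>(2))
  ultimately have "Q holomorphic_on ?B"
    unfolding Q_def [abs_def] by (intro holomorphic_intros) auto
  moreover have "Q ?\<rho> = 1" by (simp add: Q_def S_def deriv_kernel_radius)
  moreover have "Q has_fps_expansion ((fps_const ?\<rho> - fps_X) * inverse kernel_fps)"
  proof -
    have "(\<lambda>z. (?\<rho> - z) * inverse (kernel z)) has_fps_expansion ((fps_const ?\<rho> - fps_X) * inverse kernel_fps)"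
      by (intro fps_expansion_intros kernel_has_fps_expansion) (simp add: kernel_fps_0)
    moreover have "eventually (\<lambda>z. z \<in> - {?\<rho>}) (nhds 0)"
      using radius_pos by (intro eventually_nhds_in_open) auto
    then have "eventually (\<lambda>z. Q z = (?\<rho> - z) * inverse (kernel z)) (nhds 0)"
      by eventually_elim (auto simp: Q_def S_def \<rho>(2) divide_simps)
    ultimately show ?thesis
      unfolding has_fps_expansion_def by (auto elim: eventually_elim2)
  qed
  ultimately show thesis by (rule that)
qed

lemma coeff_asymptotics:
  shows motzkin_fps_asymptotics:
      "(\<lambda>n. fps_nth motzkin_fps n * of_real radius ^ Suc n) \<longlonglongrightarrow> 1"
    and ascent_fps_asymptotics:
      "(\<lambda>n. fps_nth ascent_fps n * of_real radius ^ Suc n) \<longlonglongrightarrow> of_real (exp (radius / 2))"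
proof -
  let ?\<rho> = "complex_of_real radius" and ?B = "ball 0 (2 * radius) :: complex set"
  obtain Q where Q: "Q holomorphic_on ?B" "Q ?\<rho> = 1"
    "Q has_fps_expansion ((fps_const ?\<rho> - fps_X) * inverse kernel_fps)"
    by (rule inverse_kernel_simple_pole)
  have \<rho>: "?\<rho> \<noteq> 0" "norm ?\<rho> < 2 * radius" using radius_pos by simp_all

  \<comment> \<open>\<open>g\<close> and \<open>k\<close> extend \<open>(\<rho> - z) M(z)\<close> and \<open>(\<rho> - z) H(z)\<close> over the pole.\<close>
  define g where "g z = - deriv kernel z * Q z - (?\<rho> - z) * (1 / 2)" for z
  have "(\<lambda>n. fps_nth motzkin_fps n * ?\<rho> ^ Suc n) \<longlonglongrightarrow> g ?\<rho>"
  proof (rule coeff_asymptotics_simple_pole[OF _ \<rho>])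
    show "g holomorphic_on ?B"
      unfolding g_def [abs_def] by (intro holomorphic_intros Q kernel_holomorphic) auto
    have "g has_fps_expansion (- fps_deriv kernel_fps * ((fps_const ?\<rho> - fps_X) * inverse kernel_fps)
        - (fps_const ?\<rho> - fps_X) * fps_const (1 / 2))"
      unfolding g_def [abs_def] by (intro fps_expansion_intros kernel_has_fps_expansion Q)
    then show "g has_fps_expansion ((fps_const ?\<rho> - fps_X) * motzkin_fps)"
      by (simp add: motzkin_fps_def algebra_simps)
  qed
  then show "(\<lambda>n. fps_nth motzkin_fps n * ?\<rho> ^ Suc n) \<longlonglongrightarrow> 1"
    by (simp add: g_def deriv_kernel_radius Q)

  define k where "k z = exp (1 / 2 * z) * Q z" for z
  have "(\<lambda>n. fps_nth ascent_fps n * ?\<rho> ^ Suc n) \<longlonglongrightarrow> k ?\<rho>"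
  proof (rule coeff_asymptotics_simple_pole[OF _ \<rho>])
    show "k holomorphic_on ?B"
      unfolding k_def [abs_def] by (intro holomorphic_intros Q)
    have "k has_fps_expansion (fps_exp (1 / 2) * ((fps_const ?\<rho> - fps_X) * inverse kernel_fps))"
      unfolding k_def [abs_def] by (intro fps_expansion_intros Q)
    then show "k has_fps_expansion ((fps_const ?\<rho> - fps_X) * ascent_fps)"
      by (simp add: ascent_fps_def algebra_simps)
  qed
  moreover have "k ?\<rho> = of_real (exp (radius / 2))"
    by (simp add: k_def Q flip: exp_of_real)
  ultimately show "(\<lambda>n. fps_nth ascent_fps n * ?\<rho> ^ Suc n) \<longlonglongrightarrow> of_real (exp (radius / 2))" by simp
qed

section \<open>The average number of descents\<close>

lemma expectation_eq_coeffs: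
  assumes "n \<ge> 1"
  shows "complex_of_real (measure_pmf.expectation (pmf_of_set (DMot n)) (\<lambda>T. real (des (postorder T) + 1)) / real (n + 1))
    = 1 + (fps_nth motzkin_fps (n + 1) - fps_nth ascent_fps (n + 1)) / fps_nth motzkin_fps n"
proof -
  have card: "card (DMot n) \<noteq> 0"
    using finite_DMot DMot_nonempty[OF assms] by simp
  have "measure_pmf.expectation (pmf_of_set (DMot n)) (\<lambda>T. real (des (postorder T) + 1)) =
      (\<Sum>T\<in>DMot n. real (des (postorder T) + 1)) / real (card (DMot n))"
    by (rule integral_pmf_of_set[OF DMot_nonempty[OF assms] finite_DMot])
  also have "\<dots> = 1 + (\<Sum>T\<in>DMot n. real (des (postorder T))) / real (card (DMot n))"
    using card by (simp add: sum.distrib add_divide_distrib)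
  finally have "complex_of_real (measure_pmf.expectation (pmf_of_set (DMot n)) (\<lambda>T. real (des (postorder T) + 1)))
      = 1 + des_total {1..n} / dmot_count {1..n}"
    by (simp add: des_total_def dmot_count_def DMot_eq_dmot_on)
  also have "\<dots> = of_nat (n + 1) +
      of_nat (n + 1) * (fps_nth motzkin_fps (n + 1) - fps_nth ascent_fps (n + 1)) / fps_nth motzkin_fps n"
    using mean_descents[OF motzkin_fps_0 motzkin_fps_ode ascent_fps_0 ascent_fps_ode assms] by simp
  finally show ?thesis
    by (simp add: add_divide_distrib del: of_nat_Suc of_nat_add)
qed

lemma limit_constant:
  "1 + (1 - exp (radius / 2)) / radius = 1 - 3 * sqrt 3 / (2 * pi) * (exp (pi / (3 * sqrt 3)) - 1)"
  by (simp add: radius_def field_simps)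

text \<open>
  Asymptotic equivalence to a multiple of \<open>n\<close> follows from convergence of the quotient only for a
  nonzero limit. With \<open>x = \<rho> / 2 < 1\<close>, the claim is \<open>e\<^sup>x < 1 + 2 x\<close>.
\<close>

lemma limit_constant_pos: "1 + (1 - exp (radius / 2)) / radius > 0"
proof -
  define x where "x = radius / 2"
  have "3 < 3 * sqrt 3" "pi < 4" using pi_less_4 by simp_all
  moreover have "(5 / 3)\<^sup>2 < (3 :: real)" by (simp add: power2_eq_square)
  then have "5 / 3 < sqrt 3" by (rule real_less_rsqrt)
  ultimately have x: "0 < x" "x < 1"
    by (simp_all add: x_def radius_def)
  then have "exp x \<le> 1 + x + x\<^sup>2" by (intro exp_bound) auto
  also have "x\<^sup>2 < x" using x by (simp add: power2_eq_square)
  finally have "exp x < 1 + radius" by (simp add: x_def)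
  then show ?thesis using radius_pos by (simp add: x_def field_simps)
qed

theorem theorem7p20:
  shows "(\<lambda>n. measure_pmf.expectation (pmf_of_set (DMot (n - 1)))
                (\<lambda>T. real (des (postorder T) + 1)))
         \<sim>[at_top]
         (\<lambda>n. (1 - 3 * sqrt 3 / (2 * pi) * (exp (pi / (3 * sqrt 3)) - 1)) * real n)"
proof -
  let ?E = "\<lambda>n. measure_pmf.expectation (pmf_of_set (DMot (n - 1))) (\<lambda>T. real (des (postorder T) + 1))"
  let ?\<rho> = "complex_of_real radius" and ?c = "1 + (1 - exp (radius / 2)) / radius"
  define m where "m n = fps_nth motzkin_fps n * ?\<rho> ^ Suc n" for n
  define a where "a n = fps_nth ascent_fps n * ?\<rho> ^ Suc n" for n
  have m: "m \<longlonglongrightarrow> 1" and a: "a \<longlonglongrightarrow> of_real (exp (radius / 2))"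
    unfolding m_def [abs_def] a_def [abs_def] by (rule coeff_asymptotics)+
  have "(\<lambda>n. 1 + (m (Suc n) - a (Suc n)) / m n / ?\<rho>) \<longlonglongrightarrow> 1 + (1 - of_real (exp (radius / 2))) / 1 / ?\<rho>"
    using radius_pos by (intro tendsto_intros LIMSEQ_Suc m a) auto
  moreover have "eventually (\<lambda>n. 1 + (m (Suc n) - a (Suc n)) / m n / ?\<rho> = of_real (?E (Suc n) / real (Suc n))) sequentially"
    using eventually_ge_at_top[of 1]
  proof eventually_elim
    case (elim n)
    have "(m (Suc n) - a (Suc n)) / m n / ?\<rho>
        = (fps_nth motzkin_fps (Suc n) - fps_nth ascent_fps (Suc n)) / fps_nth motzkin_fps n"
      using radius_pos by (simp add: m_def a_def flip: left_diff_distrib)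
    with expectation_eq_coeffs[OF elim] show ?case by simp
  qed
  ultimately have "(\<lambda>n. of_real (?E (Suc n) / real (Suc n))) \<longlonglongrightarrow> complex_of_real ?c"
    by (auto dest: Lim_transform_eventually)
  then have "(\<lambda>n. ?E (Suc n) / real (Suc n)) \<longlonglongrightarrow> ?c"
    unfolding tendsto_of_real_iff .
  then have "(\<lambda>n. ?E n / real n) \<longlonglongrightarrow> ?c"
    by (rule LIMSEQ_imp_Suc)
  then have "?E \<sim>[at_top] (\<lambda>n. ?c * real n)"
    using limit_constant_pos by (intro asymp_equivI'_const) auto
  then show ?thesis unfolding limit_constant .
qed

end
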